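(* The family $$\left\{\mathbb{Q}\left(\sqrt{-F_{50s+25}}\right) : s\in\mathbb{Z}^{+},\ s\not\equiv 1\pmod 3\right\}$$ contains infinitely many distinct imaginary quadratic fields.
   Context: $F_n$ denotes the $n$-th Fibonacci number: $F_1=1$, $F_2=1$, $F_{n+2}=F_{n+1}+F_n$ for $n\geq 1$. $\mathbb{Z}^{+}$ is the set of positive integers. *)

theory Defs
  imports
    "HOL-Algebra.Algebraic_Closure_Type"
    "HOL-Algebra.Generated_Fields"
    "HOL-Number_Theory.Fib"
    "HOL-Number_Theory.Cong"
begin

text \<open>
  Number fields are treated as concrete subfields of \<open>\<complex>\<close>, i.e. as sets of complex numbers,
  so that distinct fields are distinct sets. For quadratic fields this agrees with
  non-isomorphism, a quadratic extension of \<open>\<rat>\<close> being normal.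
\<close>

abbreviation complex_field :: "complex ring"
  where "complex_field \<equiv> ring_of_type_algebra"

definition rat_adjoin :: "complex \<Rightarrow> complex set"
  where "rat_adjoin z = generate_field complex_field (insert z \<rat>)"

definition imaginary_quadratic_field :: "complex set \<Rightarrow> bool"
  where "imaginary_quadratic_field K \<longleftrightarrow>
           subfield K complex_field \<and> ring.dimension complex_field 2 \<rat> K \<and> \<not> K \<subseteq> \<real>"

end

theory Submission
  imports Defs "HOL-Computational_Algebra.Nth_Powers"
begin

text \<open>
  If \<open>m\<close> and \<open>m'\<close> are coprime, then \<open>gcd (F\<^bsub>25m\<^esub>, F\<^bsub>25m'\<^esub>) = F\<^sub>2\<^sub>5\<close>, so the cofactors
  \<open>F\<^bsub>25m\<^esub> / F\<^sub>2\<^sub>5\<close> and \<open>F\<^bsub>25m'\<^esub> / F\<^sub>2\<^sub>5\<close> are coprime. If both indices gave the same field,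
  \<open>F\<^bsub>25m\<^esub> F\<^bsub>25m'\<^esub>\<close> would be a square, hence so would each cofactor. But the Fibonacci sequence
  has period 12 modulo 8, and for \<open>m \<equiv> 5 (mod 12)\<close> the cofactor is \<open>\<equiv> 5 (mod 8)\<close>.
  The Fermat numbers \<open>m = 2^(2^(k+1)) + 1 = 2s + 1\<close> provide infinitely many pairwise coprime
  \<open>m \<equiv> 5 (mod 12)\<close>, with \<open>s \<equiv> 2 (mod 3)\<close>.
\<close>

section \<open>Quadratic fields\<close>

lemma complex_field_simps [simp]:
  "carrier complex_field = UNIV"
  "x \<otimes>\<^bsub>complex_field\<^esub> y = x * y"
  "\<one>\<^bsub>complex_field\<^esub> = 1"
  "\<zero>\<^bsub>complex_field\<^esub> = 0"
  "x \<oplus>\<^bsub>complex_field\<^esub> y = x + y"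
  by (simp_all add: ring_of_type_algebra_def)

interpretation complex_field: cring complex_field
  by (rule cring_from_type_algebra)

lemma complex_field_a_inv [simp]: "\<ominus>\<^bsub>complex_field\<^esub> x = - x"
  by (rule complex_field.minus_equality) auto

lemma complex_field_m_inv [simp]:
  assumes "x \<noteq> 0"
  shows "inv\<^bsub>complex_field\<^esub> x = inverse x"
  using assms by (intro complex_field.comm_inv_char) auto

lemma subfield_complex_fieldI:
  assumes "1 \<in> K" "\<And>x. x \<in> K \<Longrightarrow> - x \<in> K" "\<And>x. x \<in> K \<Longrightarrow> x \<noteq> 0 \<Longrightarrow> inverse x \<in> K"
    "\<And>x y. x \<in> K \<Longrightarrow> y \<in> K \<Longrightarrow> x + y \<in> K" "\<And>x y. x \<in> K \<Longrightarrow> y \<in> K \<Longrightarrow> x * y \<in> K"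
  shows "subfield K complex_field"
  using assms by (intro field.subfieldI' [OF field_from_type_algebra] complex_field.subringI) auto

lemma subfield_Rats: "subfield \<rat> complex_field"
  by (rule subfield_complex_fieldI) auto

lemma Rats_complex_subset_Reals: "\<rat> \<subseteq> (\<real> :: complex set)"
  by (auto elim!: Rats_cases' simp: Reals_divide)

text \<open>Any subfield containing \<open>z\<close> and the rationals contains all
  \<open>a + b * z\<close>. Conversely, these numbers already form a field: \<open>z\<^sup>2\<close>
  being rational gives closure under products, and rationalising the denominator gives
  inverses.\<close>

lemma rat_adjoin_eq:
  assumes sq: "z\<^sup>2 \<in> \<rat>" and z: "z \<notin> \<rat>"
  shows "rat_adjoin z = {a + b * z | a b. a \<in> \<rat> \<and> b \<in> \<rat>}"
  unfolding rat_adjoin_def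
proof (rule field.generate_fieldI [OF field_from_type_algebra, symmetric])
  let ?E = "{a + b * z | a b. a \<in> \<rat> \<and> b \<in> \<rat>}"
  have I: "x \<in> ?E" if "x = a + b * z" "a \<in> \<rat>" "b \<in> \<rat>" for x a b
    using that by blast
  show "insert z \<rat> \<subseteq> carrier complex_field" by simp
  show "subfield ?E complex_field"
  proof (rule subfield_complex_fieldI)
    show "1 \<in> ?E" by (rule I [of _ 1 0]) auto
  next
    fix x assume "x \<in> ?E"
    then obtain a b where x: "x = a + b * z" "a \<in> \<rat>" "b \<in> \<rat>" by blast
    show "- x \<in> ?E" by (rule I [of _ "-a" "-b"]) (use x in auto)
    \<comment> \<open>The norm of \<open>x\<close>, i.e. \<open>x\<close> times its conjugate
      \<open>a - b * z\<close>. The conjugate cannot vanish, since otherwise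
      \<open>z = a / b\<close> would be rational or \<open>x\<close> would be 0.\<close>
    define N where "N = a\<^sup>2 - b\<^sup>2 * z\<^sup>2"
    have N: "N \<in> \<rat>" unfolding N_def using x sq by auto
    assume "x \<noteq> 0"
    have "a - b * z \<noteq> 0"
    proof
      assume eq: "a - b * z = 0"
      show False
      proof (cases "b = 0")
        case True
        with eq x \<open>x \<noteq> 0\<close> show False by simp
      next
        case False
        with eq have "z = a / b" by (simp add: field_simps)
        with x z show False by auto
      qed
    qed
    moreover have "N = x * (a - b * z)"
      by (simp add: N_def x power2_eq_square algebra_simps)
    ultimately have "inverse x = a / N + (- b / N) * z"
      using \<open>x \<noteq> 0\<close> by (simp add: divide_simps)
    then show "inverse x \<in> ?E"
      by (rule I) (use x N in auto)
  next
    fix x y assume "x \<in> ?E" "y \<in> ?E"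
    then obtain a b c d where x: "x = a + b * z" "a \<in> \<rat>" "b \<in> \<rat>"
      and y: "y = c + d * z" "c \<in> \<rat>" "d \<in> \<rat>" by blast
    show "x + y \<in> ?E"
      by (rule I [of _ "a + c" "b + d"]) (use x y in \<open>auto simp: algebra_simps\<close>)
    show "x * y \<in> ?E"
      by (rule I [of _ "a * c + b * d * z\<^sup>2" "a * d + b * c"])
        (use x y sq in \<open>auto simp: algebra_simps power2_eq_square\<close>)
  qed
  show "insert z \<rat> \<subseteq> ?E"
    using I [of z 0 1] I [of _ _ 0] by auto
  fix K assume K: "subfield K complex_field" "insert z \<rat> \<subseteq> K"
  note props = complex_field.subring_props [OF K(1), simplified]
  show "?E \<subseteq> K"
    using K(2) by (auto intro!: props)
qed

lemma imaginary_quadratic_field_rat_adjoin: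
  assumes sq: "z\<^sup>2 \<in> \<rat>" and z: "z \<notin> \<real>"
  shows "imaginary_quadratic_field (rat_adjoin z)"
proof -
  have zQ: "z \<notin> \<rat>" using z Rats_complex_subset_Reals by blast
  note eq = rat_adjoin_eq [OF sq zQ]
  \<comment> \<open>The rationals have dimension 1 over themselves, and adjoining the line spanned
    by \<open>z\<close>, which lies outside them, raises the dimension by one.\<close>
  have "complex_field.dimension (Suc 1) \<rat> (complex_field.line_extension \<rat> z \<rat>)"
    by (rule complex_field.Suc_dim)
      (use zQ complex_field.dimension_one [OF subfield_Rats] in auto)
  moreover have "complex_field.line_extension \<rat> z \<rat> = rat_adjoin z"
    unfolding eq by (auto simp: complex_field.line_extension_mem_iff) (metis add.commute)+
  moreover have "subfield (rat_adjoin z) complex_field"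
    unfolding rat_adjoin_def by (rule field.generate_field_is_subfield [OF field_from_type_algebra]) auto
  moreover have "z \<in> rat_adjoin z"
    unfolding rat_adjoin_def by (rule generate_field.incl) auto
  ultimately show ?thesis
    using z by (auto simp: imaginary_quadratic_field_def numeral_2_eq_2)
qed

text \<open>The principal root of a nonpositive real lies on the nonnegative imaginary axis; this
  form lets imaginary parts be compared below.\<close>

lemma csqrt_neg_of_nat: "csqrt (- of_nat n) = \<i> * of_real (sqrt (real n))"
  using csqrt_of_real_nonpos [of "- real n"] by simp

lemma csqrt_neg_of_nat_notin_Reals:
  assumes "n > 0"
  shows "csqrt (- of_nat n) \<notin> \<real>"
  using assms unfolding csqrt_neg_of_nat by (simp add: complex_is_Real_iff)

lemma csqrt_neg_of_nat_power2_in_Rats: "(csqrt (- of_nat n))\<^sup>2 \<in> \<rat>"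
  unfolding power2_csqrt by simp

text \<open>Write the root of \<open>-n\<close> as \<open>a + b * ?z\<close> with \<open>a\<close>,
  \<open>b\<close> rational. Taking imaginary parts removes \<open>a\<close> and leaves
  \<open>sqrt n = b * sqrt m\<close>, so \<open>m * n\<close> is the square of the rational
  \<open>b * m\<close>, hence of an integer.\<close>

lemma is_square_mult_if_rat_adjoin_eq:
  assumes "m > 0"
    and eq: "rat_adjoin (csqrt (- of_nat m)) = rat_adjoin (csqrt (- of_nat n))"
  shows "is_square (m * n)"
proof -
  let ?z = "csqrt (- of_nat m)" and ?w = "csqrt (- of_nat n)"
  have "?z \<notin> \<rat>"
    using csqrt_neg_of_nat_notin_Reals [OF assms(1)] Rats_complex_subset_Reals by blast
  moreover have "?z\<^sup>2 \<in> \<rat>" by (rule csqrt_neg_of_nat_power2_in_Rats)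
  moreover have "?w \<in> rat_adjoin ?w"
    unfolding rat_adjoin_def by (rule generate_field.incl) auto
  ultimately obtain a b where ab: "a \<in> \<rat>" "b \<in> \<rat>" "?w = a + b * ?z"
    unfolding eq [symmetric] by (subst (asm) rat_adjoin_eq) blast+
  from ab(2) obtain u v where v: "v > 0" and b: "b = of_int u / of_int v"
    by (rule Rats_cases')
  have "Im a = 0"
    using ab(1) Rats_complex_subset_Reals complex_is_Real_iff by blast
  moreover have "b = of_real (of_int u / of_int v)" by (simp add: b)
  ultimately have "sqrt (real n) = of_int u / of_int v * sqrt (real m)"
    using arg_cong [OF ab(3), of Im] unfolding csqrt_neg_of_nat by simp
  then have "of_int v * sqrt (real n) = of_int u * sqrt (real m)"
    using v by (simp add: field_simps)
  then have "(of_int v * sqrt (real n))\<^sup>2 = (of_int u * sqrt (real m))\<^sup>2" by simp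
  then have "real_of_int (v\<^sup>2 * int n) = real_of_int (u\<^sup>2 * int m)"
    by (simp add: power_mult_distrib)
  then have "v\<^sup>2 * int n = u\<^sup>2 * int m" by (simp only: of_int_eq_iff)
  then have vu: "v\<^sup>2 * int (m * n) = (u * int m)\<^sup>2"
    by (simp add: power2_eq_square)
  \<comment> \<open>Divisibility of squares descends to the bases, so the denominator
    \<open>v\<close> cancels from \<open>u * m / v\<close>.\<close>
  then have "v\<^sup>2 dvd (u * int m)\<^sup>2" by (metis dvd_triv_left)
  then have "v dvd u * int m" by simp
  then obtain t where "u * int m = v * t" ..
  with vu v have "int (m * n) = t\<^sup>2" by (simp add: power_mult_distrib)
  then have "int (m * n) = int ((nat \<bar>t\<bar>)\<^sup>2)" by simp
  then have "m * n = (nat \<bar>t\<bar>)\<^sup>2" by (simp only: of_nat_eq_iff)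
  then show ?thesis unfolding is_nth_power_def by blast
qed

section \<open>Fibonacci numbers\<close>

lemma fib_cong_period_12: "[fib (n + 12) = fib n] (mod 8)"
proof (cases n)
  case (Suc k)
  have "fib 12 = 144" "fib 13 = 233" by code_simp+
  \<comment> \<open>The addition formula gives \<open>233 * fib (Suc k) + 144 * fib k\<close>, where
    233 = 8 * 29 + 1 and 144 = 8 * 18. It involves the predecessor \<open>k\<close> of
    \<open>n\<close>, so \<open>n = 0\<close> is treated apart.\<close>
  then have "fib (n + 12) = 8 * (29 * fib (Suc k) + 18 * fib k) + fib n"
    using fib_add [of k 12] by (simp add: Suc algebra_simps)
  then show ?thesis by (simp only: cong_def mod_mult_self4)
next
  case 0
  have "fib 12 = 144" by code_simp
  then show ?thesis by (simp add: 0 cong_def)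
qed

lemma fib_mod_8: "fib n mod 8 = fib (n mod 12) mod 8"
proof -
  have "[fib (n + 12 * k) = fib n] (mod 8)" for n k
  proof (induction k)
    case (Suc k)
    then show ?case
      using fib_cong_period_12 [of "n + 12 * k"] by (auto simp: algebra_simps intro: cong_trans)
  qed simp
  from this [of "n mod 12" "n div 12"] show ?thesis by (simp add: cong_def)
qed

text \<open>The only squares modulo 8 are 0, 1 and 4.\<close>

lemma square_mod_8_neq_5: "(x :: nat)\<^sup>2 mod 8 \<noteq> 5"
proof -
  have "x mod 8 \<in> {0, 1, 2, 3, 4, 5, 6, 7}" by auto
  then have "(x mod 8)\<^sup>2 mod 8 \<noteq> 5" by auto
  then show ?thesis by (simp add: power_mod)
qed

lemma fib_25_mult_not_square:
  assumes "m mod 12 = 5" "n mod 12 = 5" "coprime m n"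
  shows "\<not> is_square (fib (25 * m) * fib (25 * n))"
proof
  assume square: "is_square (fib (25 * m) * fib (25 * n))"
  have pos: "fib 25 > 0" by (rule fib_neq_0_nat) simp
  have dvd: "fib 25 dvd fib (25 * k)" for k
    using fib_gcd [of 25 "25 * k"] by (metis gcd_dvd2 gcd_nat.absorb1 dvd_triv_left)
  obtain A B where A: "fib (25 * m) = fib 25 * A" and B: "fib (25 * n) = fib 25 * B"
    using dvd [of m] dvd [of n] by (auto elim!: dvdE)
  have "gcd (25 * m) (25 * n) = 25"
    using assms(3) by (simp add: gcd_mult_distrib_nat [symmetric] coprime_iff_gcd_eq_1)
  then have "gcd (fib 25 * A) (fib 25 * B) = fib 25"
    using fib_gcd [of "25 * m" "25 * n"] A B by simp
  then have "fib 25 * gcd A B = fib 25 * 1"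
    by (simp add: gcd_mult_distrib_nat)
  then have coprime: "coprime A B" using pos by (simp add: coprime_iff_gcd_eq_1)
  have mod: "fib (25 * m) mod 8 = 5"
  proof -
    have "25 * m mod 12 = 5" using assms(1) mod_mult_self4 [of 12 "2 * m" m] by simp
    moreover have "fib 5 = 5" by code_simp
    ultimately show ?thesis by (subst fib_mod_8) simp
  qed
  \<comment> \<open>Since 25 is 1 modulo 12, \<open>fib 25\<close> is \<open>fib 1\<close> modulo 8;
    hence passing to the cofactor \<open>A\<close> keeps the residue 5.\<close>
  have "fib 25 mod 8 = 1" by (subst fib_mod_8) simp
  then have A5: "A mod 8 = 5"
    using mod mod_mult_left_eq [of "fib 25" 8 A] unfolding A by simp
  from square obtain c where c: "fib 25 * A * (fib 25 * B) = c ^ 2"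
    unfolding A B by (auto simp: is_nth_power_def)
  have "fib 25 ^ 2 dvd c ^ 2" unfolding c [symmetric] by (simp add: power2_eq_square)
  then obtain d where "c = fib 25 * d" by (auto elim: dvdE)
  with c have "fib 25 ^ 2 * (A * B) = fib 25 ^ 2 * d ^ 2"
    by (simp add: power2_eq_square ac_simps)
  then have "A * B = d ^ 2" using pos by simp
  then have "is_square (A * B)" unfolding is_nth_power_def by blast
  then have "is_square A" using is_nth_power_mult_coprime_nat_iff [OF coprime] by blast
  then show False
    using A5 square_mod_8_neq_5 by (auto simp: is_nth_power_def)
qed

text \<open>Modulo a common divisor \<open>d\<close>, the number \<open>2 ^ 2 ^ l\<close> is -1, but
  as an even power of \<open>2 ^ 2 ^ k\<close>, itself -1, it is also 1. So \<open>d\<close> divides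
  2, while Fermat numbers are odd.\<close>

lemma coprime_fermat_numbers:
  assumes "k < l"
  shows "coprime (2 ^ 2 ^ k + 1 :: nat) (2 ^ 2 ^ l + 1)"
proof (rule coprimeI)
  fix d :: nat assume d: "d dvd 2 ^ 2 ^ k + 1" "d dvd 2 ^ 2 ^ l + 1"
  obtain j where l: "l = Suc (k + j)" using assms less_iff_Suc_add by auto
  have "[2 ^ 2 ^ k = - 1] (mod int d)"
    using d(1) by (simp add: cong_iff_dvd_diff add.commute flip: int_dvd_int_iff)
  then have "[(2 ^ 2 ^ k) ^ 2 ^ Suc j = (- 1) ^ 2 ^ Suc j] (mod int d)"
    by (rule cong_pow)
  then have "[2 ^ 2 ^ l = 1] (mod int d)"
    by (simp add: l power_add mult.left_commute flip: power_mult)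
  then have "int d dvd 2 ^ 2 ^ l - 1" by (simp add: cong_iff_dvd_diff)
  moreover have "int d dvd 2 ^ 2 ^ l + 1"
    using d(2) by (simp add: add.commute flip: int_dvd_int_iff)
  ultimately have "int d dvd (2 ^ 2 ^ l + 1) - (2 ^ 2 ^ l - 1)" by (rule dvd_diff [rotated])
  then have "d dvd 2" by (simp flip: int_dvd_int_iff)
  moreover have "odd d"
  proof
    assume "even d"
    then have "even (2 ^ 2 ^ k + 1 :: nat)" using d(1) by (rule dvd_trans)
    then show False by simp
  qed
  ultimately show "is_unit d"
    using two_is_prime_nat unfolding prime_nat_iff by auto
qed

lemma fermat_number_mod_12: "(2 ^ 2 ^ Suc k + 1 :: nat) mod 12 = 5"
proof -
  have "(4 :: nat) ^ Suc j mod 12 = 4" for j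
  proof (induction j)
    case (Suc j)
    then show ?case using mod_mult_right_eq [of 4 "4 ^ Suc j" "12 :: nat"] by simp
  qed simp
  \<comment> \<open>\<open>2 ^ 2 ^ Suc k\<close> is 4 to the positive power \<open>2 ^ k\<close>.
    The \<open>Suc\<close> matters: the first Fermat number, 3, is not 5 modulo 12.\<close>
  from this [of "2 ^ k - 1"] have "(2 ^ 2 ^ Suc k :: nat) mod 12 = 4"
    by (simp add: power_mult)
  moreover have "x mod 12 = 4 \<Longrightarrow> (x + 1) mod 12 = 5" for x :: nat by presburger
  ultimately show ?thesis by blast
qed

theorem theorem4:
  shows "infinite {K \<in> {rat_adjoin (csqrt (- of_nat (fib (50 * s + 25)))) | s :: nat.
                          s > 0 \<and> \<not> [s = 1] (mod 3)}.
                    imaginary_quadratic_field K}"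
    (is "infinite ?S")
proof -
  define m where "m k = (2 ^ 2 ^ Suc k + 1 :: nat)" for k :: nat
  define f where "f k = rat_adjoin (csqrt (- of_nat (fib (25 * m k))))" for k
  have m: "m k mod 12 = 5" for k
    unfolding m_def by (rule fermat_number_mod_12)
  have pos: "fib (25 * m k) > 0" for k
    by (rule fib_neq_0_nat) (simp add: m_def)
  have "f k \<in> ?S" for k
  proof -
    define s where "s = m k div 2"
    \<comment> \<open>From \<open>m k\<close> being 5 modulo 12, it is odd and its half
      \<open>s\<close> is 2 modulo 6.\<close>
    have "m k = 2 * s + 1" "s > 0" "s mod 3 = 2"
      using m [of k] unfolding s_def by presburger+
    then have "25 * m k = 50 * s + 25" "s > 0" "\<not> [s = 1] (mod 3)"
      by (simp_all add: cong_def)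
    moreover have "imaginary_quadratic_field (f k)"
      unfolding f_def using pos
      by (intro imaginary_quadratic_field_rat_adjoin csqrt_neg_of_nat_power2_in_Rats
          csqrt_neg_of_nat_notin_Reals)
    ultimately show ?thesis by (auto simp: f_def)
  qed
  moreover have "f k \<noteq> f l" if "k < l" for k l
  proof
    assume "f k = f l"
    then have "is_square (fib (25 * m k) * fib (25 * m l))"
      unfolding f_def using pos by (intro is_square_mult_if_rat_adjoin_eq)
    moreover have "coprime (m k) (m l)"
      unfolding m_def using that by (intro coprime_fermat_numbers) simp
    ultimately show False using fib_25_mult_not_square [OF m m] by blast
  qed
  then have "inj f" by (rule linorder_injI)
  ultimately show ?thesis
    using finite_subset [of "range f" ?S] range_inj_infinite [of f] by blast
qed

end
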